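(* Let $G$ be a negatively curved (i.e. word-hyperbolic) group and let $H$ be a quasiconvex subgroup of $G$. Then $\mathrm{WeakWidth}(H,G)$ is finite.
   Context: Negatively curved groups. Let $G$ be a group generated by a finite set $X$, and let $X^*=\{x,x^{-1}\mid x\in X\}$. The Cayley graph $\mathrm{Cayley}(G)$ has vertex set $G$ and edge set $G\times X^*$, where the edge $(g,x)$ joins $g$ to $gx$; each edge has length $1$. $G$ is $\delta$-negatively curved ($\delta\ge 0$) if in every geodesic triangle in $\mathrm{Cayley}(G)$ each side is contained in the $\delta$-neighborhood of the union of the other two sides. $G$ is negatively curved if it is finitely generated and $\delta$-negatively curved for some $\delta\ge 0$ (with respect to some finite generating set). Quasiconvexity. A subgroup $H$ of $G$ is $K$-quasiconvex ($K\ge 0$) if every vertex of every geodesic in $\mathrm{Cayley}(G)$ with both endpoints in $H$ is at distance at most $K$ from some element of $H$. $H$ is quasiconvex if it is $K$-quasiconvex for some $K\ge 0$. Weak width. Let $H$ be a subgroup of a group $G$. Elements $g_i\in G$ are called strongly $H$-essentially distinct if $Hg_iH\ne Hg_jH$ for $i\ne j$. Conjugates $g_i^{-1}Hg_i$ of $H$ by strongly $H$-essentially distinct elements are called strongly essentially distinct conjugates (distinctness refers to the conjugating elements, not to the conjugate subgroups as sets). If $H$ is infinite, $\mathrm{WeakWidth}(H,G)=n$ if there exists a collection of $n$ strongly essentially distinct conjugates $\{H, g_1^{-1}Hg_1,\dots,g_{n-1}^{-1}Hg_{n-1}\}$ of $H$ in $G$ (with $H$ itself being the conjugate by the identity element,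 so the elements $1,g_1,\dots,g_{n-1}$ lie in pairwise distinct double cosets of $H$) such that the intersection $H\cap g_i^{-1}Hg_i$ is infinite for all $1\le i\le n-1$, and $n$ is maximal possible; it is infinite if no maximal such $n$ exists. If $H$ is finite, $\mathrm{WeakWidth}(H,G)=0$. *)

theory Defs
  imports
    Complex_Main
    "HOL-Library.Extended_Nat"
    "HOL-Algebra.Generated_Groups"
    "Graph_Theory.Arc_Walk"
begin

section \<open>Graphs as path-metric spaces\<close>

text \<open>
  Points of the geometric realization of a graph in which every arc has length \<open>1\<close>:
  \<open>Inner e t\<close> is the interior point of the arc \<open>e\<close> at distance \<open>t\<close> (measured along \<open>e\<close>)
  from the tail of \<open>e\<close>, where \<open>0 < t < 1\<close>.
\<close>

datatype ('v, 'e) point = Vertex 'v | Inner 'e real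

definition points :: "('v, 'e) pre_digraph \<Rightarrow> ('v, 'e) point set" where
  "points \<Gamma> = Vertex ` verts \<Gamma> \<union> {Inner e t | e t. e \<in> arcs \<Gamma> \<and> 0 < t \<and> t < 1}"

text \<open>
  Arc walks respect the direction of the arcs. We only use this distance for graphs whose set of
  arcs is closed under reversal (as for the Cayley graphs below), where it is the usual one.
  It is only meaningful if \<open>v\<close> can be reached from \<open>u\<close>.
\<close>

definition vertex_dist :: "('v, 'e) pre_digraph \<Rightarrow> 'v \<Rightarrow> 'v \<Rightarrow> nat" where
  "vertex_dist \<Gamma> u v = (LEAST n. \<exists>p. pre_digraph.awalk \<Gamma> u p v \<and> length p = n)"

text \<open>
  The pairs \<open>(v, r)\<close> such that one can leave the point through the vertex \<open>v\<close>, after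
  travelling a distance \<open>r\<close> along the arc containing it.
\<close>

fun exits :: "('v, 'e) pre_digraph \<Rightarrow> ('v, 'e) point \<Rightarrow> ('v \<times> real) set" where
  "exits \<Gamma> (Vertex v) = {(v, 0)}"
| "exits \<Gamma> (Inner e t) = {(tail \<Gamma> e, t), (head \<Gamma> e, 1 - t)}"

text \<open>Lengths of the direct connections that stay in the interior of one arc.\<close>

fun inner_lengths :: "('v, 'e) point \<Rightarrow> ('v, 'e) point \<Rightarrow> real set" where
  "inner_lengths (Inner e s) (Inner e' t) = (if e = e' then {\<bar>s - t\<bar>} else {})"
| "inner_lengths _ _ = {}"

text \<open>
  The path metric of the geometric realization: a shortest path between two points either stays in
  the interior of one arc, or leaves the first point through an end of its arc, follows a shortest
  edge path, and arrives at the second point through an end of its arc.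
\<close>

definition pdist :: "('v, 'e) pre_digraph \<Rightarrow> ('v, 'e) point \<Rightarrow> ('v, 'e) point \<Rightarrow> real" where
  "pdist \<Gamma> p q =
     Min (inner_lengths p q \<union>
          (\<lambda>((u, r), (v, s)). r + real (vertex_dist \<Gamma> u v) + s) ` (exits \<Gamma> p \<times> exits \<Gamma> q))"

definition geodesic ::
  "('v, 'e) pre_digraph \<Rightarrow> ('v, 'e) point \<Rightarrow> ('v, 'e) point \<Rightarrow> ('v, 'e) point set \<Rightarrow> bool" where
  "geodesic \<Gamma> p q S \<longleftrightarrow>
     (\<exists>(L::real) \<gamma>. 0 \<le> L \<and> \<gamma> 0 = p \<and> \<gamma> L = q \<and> S = \<gamma> ` {0..L} \<and> S \<subseteq> points \<Gamma> \<and>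
        (\<forall>s\<in>{0..L}. \<forall>t\<in>{0..L}. pdist \<Gamma> (\<gamma> s) (\<gamma> t) = \<bar>s - t\<bar>))"

definition neighborhood ::
  "('v, 'e) pre_digraph \<Rightarrow> real \<Rightarrow> ('v, 'e) point set \<Rightarrow> ('v, 'e) point set" where
  "neighborhood \<Gamma> \<delta> S = {x \<in> points \<Gamma>. \<exists>y\<in>S. pdist \<Gamma> x y \<le> \<delta>}"

definition thin_triangles :: "('v, 'e) pre_digraph \<Rightarrow> real \<Rightarrow> bool" where
  "thin_triangles \<Gamma> \<delta> \<longleftrightarrow>
     (\<forall>p q r A B C. geodesic \<Gamma> p q A \<longrightarrow> geodesic \<Gamma> q r B \<longrightarrow> geodesic \<Gamma> r p C \<longrightarrow>
        A \<subseteq> neighborhood \<Gamma> \<delta> (B \<union> C) \<and>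
        B \<subseteq> neighborhood \<Gamma> \<delta> (C \<union> A) \<and>
        C \<subseteq> neighborhood \<Gamma> \<delta> (A \<union> B))"

section \<open>Negatively curved groups and quasiconvex subgroups\<close>

definition finite_generating_set :: "('a, 'b) monoid_scheme \<Rightarrow> 'a set \<Rightarrow> bool" where
  "finite_generating_set G X \<longleftrightarrow> finite X \<and> X \<subseteq> carrier G \<and> generate G X = carrier G"

definition cayley_graph ::
  "('a, 'b) monoid_scheme \<Rightarrow> 'a set \<Rightarrow> ('a, 'a \<times> 'a) pre_digraph" where
  "cayley_graph G X =
     \<lparr>verts = carrier G,
      arcs = carrier G \<times> (X \<union> m_inv G ` X),
      tail = (\<lambda>(g, x). g),
      head = (\<lambda>(g, x). g \<otimes>\<^bsub>G\<^esub> x)\<rparr>"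

definition negatively_curved :: "('a, 'b) monoid_scheme \<Rightarrow> bool" where
  "negatively_curved G \<longleftrightarrow>
     (\<exists>X \<delta>. finite_generating_set G X \<and> 0 \<le> \<delta> \<and> thin_triangles (cayley_graph G X) \<delta>)"

definition quasiconvex :: "('a, 'b) monoid_scheme \<Rightarrow> 'a set \<Rightarrow> 'a set \<Rightarrow> bool" where
  "quasiconvex G X H \<longleftrightarrow>
     (\<exists>K\<ge>0. \<forall>a\<in>H. \<forall>b\<in>H. \<forall>S. geodesic (cayley_graph G X) (Vertex a) (Vertex b) S \<longrightarrow>
        (\<forall>v. Vertex v \<in> S \<longrightarrow>
           (\<exists>h\<in>H. pdist (cayley_graph G X) (Vertex v) (Vertex h) \<le> K)))"

section \<open>Weak width\<close>

definition double_coset :: "('a, 'b) monoid_scheme \<Rightarrow> 'a set \<Rightarrow> 'a \<Rightarrow> 'a set" where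
  "double_coset G H g = (H #>\<^bsub>G\<^esub> g) <#>\<^bsub>G\<^esub> H"

definition conjugate :: "('a, 'b) monoid_scheme \<Rightarrow> 'a set \<Rightarrow> 'a \<Rightarrow> 'a set" where
  "conjugate G H g = (inv\<^bsub>G\<^esub> g <#\<^bsub>G\<^esub> H) #>\<^bsub>G\<^esub> g"

definition strongly_essentially_distinct ::
  "('a, 'b) monoid_scheme \<Rightarrow> 'a set \<Rightarrow> nat \<Rightarrow> (nat \<Rightarrow> 'a) \<Rightarrow> bool" where
  "strongly_essentially_distinct G H n g \<longleftrightarrow>
     (\<forall>i<n. g i \<in> carrier G) \<and>
     (\<forall>i<n. \<forall>j<n. i \<noteq> j \<longrightarrow> double_coset G H (g i) \<noteq> double_coset G H (g j))"

text \<open>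
  In \<^typ>\<open>enat\<close>, the supremum of a nonempty set is its maximum if the set is finite, and \<open>\<infinity>\<close>
  otherwise. For a subgroup \<open>H\<close> the set below contains \<open>1\<close>, witnessed by the collection
  consisting of \<open>H\<close> alone.
\<close>

definition weak_width :: "('a, 'b) monoid_scheme \<Rightarrow> 'a set \<Rightarrow> enat" where
  "weak_width G H =
     (if finite H then 0
      else Sup {enat n | n. 1 \<le> n \<and>
             (\<exists>g. g 0 = \<one>\<^bsub>G\<^esub> \<and> strongly_essentially_distinct G H n g \<and>
                  (\<forall>i. 1 \<le> i \<and> i < n \<longrightarrow> infinite (H \<inter> conjugate G H (g i))))})"

end

theory Submission
  imports Defs
begin

text \<open>
  A subgroup \<open>H\<close> and its conjugate by \<open>g\<close> can only have an infinite intersection if the double coset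
  of \<open>g\<close> contains a short element. Indeed, an element of the intersection that is long compared
  with \<open>g\<close> spans a long thin quadrilateral whose long sides run near \<open>H\<close> and near the left coset of
  \<open>g\<close> inverse, by quasiconvexity. In a hyperbolic space these sides come uniformly close to each
  other (\<open>short_double_coset_representative\<close>). Since balls in a finitely generated group are finite,
  only finitely many double cosets remain, and their number bounds the weak width.

  This argument needs hyperbolicity and quasiconvexity with respect to the same generating set,
  whereas they are given for two different ones. So quasiconvexity is transported to the generating
  set \<open>Y\<close> with thin triangles (\<open>quasiconvex_change_generators\<close>). The word metrics of two finite
  generating sets are bilipschitz equivalent, so a geodesic for \<open>X\<close> is a quasigeodesic for \<open>Y\<close>, and
  in a hyperbolic space geodesics stay uniformly close to quasigeodesics with the same ends
  (\<open>geodesic_near_quasigeodesic\<close>). The latter holds because a path that avoids a large ball around a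
  point of the geodesic has a length exponential in the radius (\<open>geodesic_near_path_log\<close>), while a
  quasigeodesic detour is only linearly long.

  All of this is carried out with sequences of vertices and distances in the natural numbers. A
  sequence of vertices that realizes distances spans a geodesic of the geometric realization of the
  Cayley graph (\<open>geodesic_trace\<close>), which makes the hypotheses on real geodesics available for it.
\<close>

section \<open>Discrete geodesic spaces\<close>

lemma linear_le_power2:
  fixes A B :: nat
  shows "\<exists>k0. \<forall>k\<ge>k0. A * k + B \<le> 2 ^ k"
proof -
  \<comment> \<open>This makes \<open>A * (2 * m) + B\<close> at most \<open>(m + 1) * (m + 1)\<close>, so that \<open>k0 = 2 * m\<close> will do.\<close>
  define m where "m = 2 * A + B"
  have sq: "(m + 1) * (m + 1) \<le> 2 ^ (2 * m)"
  proof -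
    have "m + 1 \<le> 2 ^ m" by (metis Suc_eq_plus1 Suc_leI less_exp)
    then have "(m + 1) * (m + 1) \<le> 2 ^ m * 2 ^ m" by (intro mult_mono) auto
    then show ?thesis by (simp add: mult_2 power_add)
  qed
  have "A * k + B \<le> 2 ^ k \<and> A \<le> 2 ^ k" if "2 * m \<le> k" for k
    using that
  proof (induction k rule: dec_induct)
    case base
    have "A * (2 * m) + B \<le> (m + 1) * (m + 1)" "A \<le> (m + 1) * (m + 1)"
      by (auto simp: m_def algebra_simps)
    then show ?case using sq by linarith
  next
    case (step k)
    then show ?case by auto
  qed
  then show ?thesis by blast
qed

text \<open>
  Geodesics as sequences of vertices. Distances along the sequence are required to be exact, so that
  each segment is again a geodesic.
\<close>

definition geodesic_seq :: "'a set \<Rightarrow> ('a \<Rightarrow> 'a \<Rightarrow> nat) \<Rightarrow> 'a \<Rightarrow> 'a \<Rightarrow> (nat \<Rightarrow> 'a) \<Rightarrow> bool" where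
  "geodesic_seq V d x y u \<longleftrightarrow> u 0 = x \<and> u (d x y) = y \<and> (\<forall>i\<le>d x y. u i \<in> V) \<and>
     (\<forall>i j. i \<le> j \<longrightarrow> j \<le> d x y \<longrightarrow> d (u i) (u j) = j - i)"

locale geodesic_space =
  fixes V :: "'a set" and d :: "'a \<Rightarrow> 'a \<Rightarrow> nat"
  assumes dist_self: "x \<in> V \<Longrightarrow> d x x = 0"
    and dist_sym: "x \<in> V \<Longrightarrow> y \<in> V \<Longrightarrow> d x y = d y x"
    and dist_triangle: "x \<in> V \<Longrightarrow> y \<in> V \<Longrightarrow> z \<in> V \<Longrightarrow> d x z \<le> d x y + d y z"
    and geodesic_exists: "x \<in> V \<Longrightarrow> y \<in> V \<Longrightarrow> \<exists>u. geodesic_seq V d x y u"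
begin

lemma geodesic_seq_in:
  assumes "geodesic_seq V d x y u" "i \<le> d x y"
  shows "u i \<in> V"
  using assms by (auto simp: geodesic_seq_def)

lemma geodesic_seq_ends:
  assumes "geodesic_seq V d x y u"
  shows "u 0 = x" "u (d x y) = y" "x \<in> V" "y \<in> V"
  using assms by (auto simp: geodesic_seq_def)

lemma geodesic_seq_dist:
  assumes "geodesic_seq V d x y u" "i \<le> j" "j \<le> d x y"
  shows "d (u i) (u j) = j - i"
  using assms by (auto simp: geodesic_seq_def)

lemma geodesic_seq_rev:
  assumes "geodesic_seq V d x y u"
  shows "geodesic_seq V d y x (\<lambda>i. u (d x y - i))"
proof -
  have V: "x \<in> V" "y \<in> V" using geodesic_seq_ends[OF assms] by auto
  have "d (u (d x y - i)) (u (d x y - j)) = j - i" if "i \<le> j" "j \<le> d x y" for i j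
  proof -
    have "d (u (d x y - i)) (u (d x y - j)) = d (u (d x y - j)) (u (d x y - i))"
      by (intro dist_sym geodesic_seq_in[OF assms]) auto
    also have "\<dots> = (d x y - i) - (d x y - j)"
      using that by (intro geodesic_seq_dist[OF assms]) auto
    finally show ?thesis using that by auto
  qed
  then show ?thesis
    using assms V dist_sym[OF V] by (auto simp: geodesic_seq_def)
qed

lemma geodesic_seq_segment:
  assumes "geodesic_seq V d x y u" "i \<le> j" "j \<le> d x y"
  shows "geodesic_seq V d (u i) (u j) (\<lambda>k. u (i + k))"
  using assms geodesic_seq_dist[OF assms] by (auto simp: geodesic_seq_def)

end

text \<open>
  Thin triangles seen on vertices alone. Since a geodesic can be reversed, it is enough to speak
  about one side, and the orientation of the other two can be chosen so that they form a path with
  the same ends.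
\<close>

locale thin_space = geodesic_space +
  fixes D :: nat
  assumes thin:
    "geodesic_seq V d x y u \<Longrightarrow> geodesic_seq V d x z v \<Longrightarrow> geodesic_seq V d z y w \<Longrightarrow> i \<le> d x y \<Longrightarrow>
     (\<exists>j\<le>d x z. d (u i) (v j) \<le> D) \<or> (\<exists>j\<le>d z y. d (u i) (w j) \<le> D)"
begin

text \<open>
  A diagonal cuts the quadrilateral into two triangles, each of which costs \<open>D\<close>.
\<close>

lemma thin_quadrilateral:
  assumes u: "geodesic_seq V d x y u" and a: "geodesic_seq V d x x' a"
    and b: "geodesic_seq V d x' y' b" and c: "geodesic_seq V d y' y c" and i: "i \<le> d x y"
  obtains (left) j where "j \<le> d x x'" "d (u i) (a j) \<le> 2 * D"
    | (opposite) j where "j \<le> d x' y'" "d (u i) (b j) \<le> 2 * D"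
    | (right) j where "j \<le> d y' y" "d (u i) (c j) \<le> 2 * D"
proof -
  have V: "x \<in> V" "y' \<in> V"
    using geodesic_seq_ends[OF u] geodesic_seq_ends[OF c] by auto
  obtain w where w: "geodesic_seq V d x y' w" using geodesic_exists[OF V] by blast
  consider j where "j \<le> d x y'" "d (u i) (w j) \<le> D" | j where "j \<le> d y' y" "d (u i) (c j) \<le> D"
    using thin[OF u w c i] by blast
  then show thesis
  proof cases
    case (1 j)
    have ui: "u i \<in> V" and wj: "w j \<in> V" using geodesic_seq_in u i w 1 by auto
    from thin[OF w a b 1(1)] show thesis
    proof (elim disjE exE conjE)
      fix k assume k: "k \<le> d x x'" "d (w j) (a k) \<le> D"
      have "d (u i) (a k) \<le> d (u i) (w j) + d (w j) (a k)"
        using dist_triangle ui wj geodesic_seq_in[OF a k(1)] by auto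
      then show thesis using left[OF k(1)] k 1 by linarith
    next
      fix k assume k: "k \<le> d x' y'" "d (w j) (b k) \<le> D"
      have "d (u i) (b k) \<le> d (u i) (w j) + d (w j) (b k)"
        using dist_triangle ui wj geodesic_seq_in[OF b k(1)] by auto
      then show thesis using opposite[OF k(1)] k 1 by linarith
    qed
  next
    case (2 j)
    then show thesis using right[of j] by linarith
  qed
qed

text \<open>
  A path with at most \<open>2 ^ k\<close> steps cannot stay far away from a geodesic with the same ends: bisecting
  the path \<open>k\<close> times gives a nest of geodesic triangles, and following the thin triangles inwards
  costs \<open>D\<close> per level, until a single step of length at most \<open>L\<close> remains. In other words, a detour
  that avoids a ball must be exponentially long in the radius of the ball.
\<close>

lemma geodesic_near_path_log:
  assumes "\<And>j. a \<le> j \<Longrightarrow> j \<le> b \<Longrightarrow> c j \<in> V"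
    and "\<And>j. a \<le> j \<Longrightarrow> j < b \<Longrightarrow> d (c j) (c (Suc j)) \<le> L"
    and "a \<le> b" "b - a \<le> 2 ^ k" "geodesic_seq V d (c a) (c b) u" "i \<le> d (c a) (c b)"
  shows "\<exists>j\<in>{a..b}. d (u i) (c j) \<le> D * k + L"
  using assms
proof (induction k arbitrary: a b u i)
  case 0
  have le: "d (c a) (c b) \<le> L"
  proof (cases "a = b")
    case True
    then show ?thesis using 0 dist_self by auto
  next
    case False
    then have "b = Suc a" using 0 by auto
    then show ?thesis using 0 by auto
  qed
  have "d (u i) (c a) = d (u 0) (u i)"
    using dist_sym geodesic_seq_in[OF 0(5)] geodesic_seq_ends[OF 0(5)] 0(6) by auto
  also have "\<dots> = i" using geodesic_seq_dist[OF 0(5)] 0(6) by auto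
  finally show ?case using 0(3,6) le by (intro bexI[of _ a]) auto
next
  case (Suc k)
  define m where "m = (a + b) div 2"
  have m: "a \<le> m" "m \<le> b" "m - a \<le> 2 ^ k" "b - m \<le> 2 ^ k"
    using Suc.prems(3,4) by (auto simp: m_def)
  have mV: "c a \<in> V" "c b \<in> V" "c m \<in> V" using Suc.prems(1,3) m by auto
  obtain v where v: "geodesic_seq V d (c a) (c m) v" using geodesic_exists mV by blast
  obtain w where w: "geodesic_seq V d (c m) (c b) w" using geodesic_exists mV by blast
  have uV: "u i \<in> V" using geodesic_seq_in Suc.prems by blast
  have combine: "\<exists>j\<in>{a..b}. d (u i) (c j) \<le> D * Suc k + L"
    if "q \<in> V" "d (u i) q \<le> D" "j \<in> {a..b}" "d q (c j) \<le> D * k + L" for q j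
  proof -
    have "d (u i) (c j) \<le> d (u i) q + d q (c j)"
      using dist_triangle uV that(1,3) Suc.prems(1) by auto
    then show ?thesis using that by (intro bexI[of _ j]) auto
  qed
  from thin[OF Suc.prems(5) v w Suc.prems(6)] show ?case
  proof (elim disjE exE conjE)
    fix l assume l: "l \<le> d (c a) (c m)" "d (u i) (v l) \<le> D"
    have "\<exists>j\<in>{a..m}. d (v l) (c j) \<le> D * k + L"
      using m Suc.prems(1,2) by (intro Suc.IH v l(1)) auto
    then obtain j where j: "j \<in> {a..m}" "d (v l) (c j) \<le> D * k + L" by blast
    show ?case using j m by (intro combine[OF geodesic_seq_in[OF v l(1)] l(2) _ j(2)]) auto
  next
    fix l assume l: "l \<le> d (c m) (c b)" "d (u i) (w l) \<le> D"
    have "\<exists>j\<in>{m..b}. d (w l) (c j) \<le> D * k + L"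
      using m Suc.prems(1,2) by (intro Suc.IH w l(1)) auto
    then obtain j where j: "j \<in> {m..b}" "d (w l) (c j) \<le> D * k + L" by blast
    show ?case using j m by (intro combine[OF geodesic_seq_in[OF w l(1)] l(2) _ j(2)]) auto
  qed
qed

text \<open>
  The same estimate for a stretch of a path that may have to be traversed backwards.
\<close>

lemma geodesic_near_subpath_log:
  assumes V: "\<And>j. j \<le> N \<Longrightarrow> c j \<in> V"
    and step: "\<And>j. j < N \<Longrightarrow> d (c j) (c (Suc j)) \<le> L"
    and ab: "a \<le> N" "b \<le> N" "b - a \<le> 2 ^ k" "a - b \<le> 2 ^ k"
    and u: "geodesic_seq V d (c a) (c b) u" and i: "i \<le> d (c a) (c b)"
  shows "\<exists>j\<le>N. d (u i) (c j) \<le> D * k + L"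
proof (cases "a \<le> b")
  case True
  have "\<exists>j\<in>{a..b}. d (u i) (c j) \<le> D * k + L"
    using True ab V step by (intro geodesic_near_path_log u i) auto
  then show ?thesis using ab(2) by (meson atLeastAtMost_iff order_trans)
next
  case False
  let ?n = "d (c a) (c b)"
  have sym: "d (c b) (c a) = ?n" using dist_sym V ab by auto
  have "\<exists>j\<in>{b..a}. d (u (?n - (?n - i))) (c j) \<le> D * k + L"
    using False ab V step geodesic_seq_rev[OF u]
    by (intro geodesic_near_path_log[where u = "\<lambda>i. u (?n - i)" and i = "?n - i"])
       (auto simp: sym)
  then have "\<exists>j\<in>{b..a}. d (u i) (c j) \<le> D * k + L" using i by simp
  then show ?thesis using ab(1) by (meson atLeastAtMost_iff order_trans)
qed

text \<open>
  This is one half of the stability of quasigeodesics: the geodesic stays close to the quasigeodesic.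
  Let \<open>E\<close> be the largest distance from a point of the geodesic to the path, attained at \<open>u i0\<close>. Step
  \<open>W = E + 2 * D + 1\<close> along the geodesic in both directions and from there jump to the path, landing at
  \<open>c jl\<close> and \<open>c jr\<close>. The two jumps are too far from \<open>u i0\<close> to matter in the resulting quadrilateral, so
  \<open>u i0\<close> is close to the geodesic from \<open>c jl\<close> to \<open>c jr\<close>. The stretch of the path between these points
  has a number of steps that is linear in \<open>E\<close>, by the quasigeodesic inequality, hence the
  logarithmic estimate applied to it bounds \<open>E\<close> by the logarithm of a linear function of \<open>E\<close>.
\<close>

lemma geodesic_near_quasigeodesic:
  "\<exists>R. \<forall>N c u i. (\<forall>j\<le>N. c j \<in> V) \<longrightarrow> (\<forall>j<N. d (c j) (c (Suc j)) \<le> L) \<longrightarrow>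
     (\<forall>j l. j \<le> l \<longrightarrow> l \<le> N \<longrightarrow> l - j \<le> M * d (c j) (c l)) \<longrightarrow>
     geodesic_seq V d (c 0) (c N) u \<longrightarrow> i \<le> d (c 0) (c N) \<longrightarrow> (\<exists>j\<le>N. d (u i) (c j) \<le> R)"
proof -
  \<comment> \<open>The coefficients are those needed in the last estimate of the proof, where the bound on \<open>E\<close>
    is substituted into the bound \<open>M * (4 * E + 4 * D + 2)\<close> for the number of steps.\<close>
  obtain k0 where k0: "\<And>k. k \<ge> k0 \<Longrightarrow> (4 * M * D) * k + M * (16 * D + 4 * L + 2) \<le> 2 ^ k"
    using linear_le_power2 by blast
  define R where "R = D * k0 + 2 * D + L"
  have "\<exists>j\<le>N. d (u i) (c j) \<le> R"
    if cV: "\<forall>j\<le>N. c j \<in> V" and step: "\<forall>j<N. d (c j) (c (Suc j)) \<le> L"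
      and quasi: "\<forall>j l. j \<le> l \<longrightarrow> l \<le> N \<longrightarrow> l - j \<le> M * d (c j) (c l)"
      and u: "geodesic_seq V d (c 0) (c N) u" and i: "i \<le> d (c 0) (c N)" for N c u i
  proof -
    let ?n = "d (c 0) (c N)"
    define P where "P E \<longleftrightarrow> (\<forall>i\<le>?n. \<exists>j\<le>N. d (u i) (c j) \<le> E)" for E
    define E where "E = (LEAST E. P E)"
    have uV: "\<And>i. i \<le> ?n \<Longrightarrow> u i \<in> V" using geodesic_seq_in[OF u] .
    have u0: "u 0 = c 0" and un: "u ?n = c N" using geodesic_seq_ends[OF u] by auto
    have ud: "d (u l) (u j) \<le> max (l - j) (j - l)" "l - j \<le> d (u l) (u j)" "j - l \<le> d (u l) (u j)"
      if "l \<le> ?n" "j \<le> ?n" for l j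
      using geodesic_seq_dist[OF u, of l j] geodesic_seq_dist[OF u, of j l] that
        dist_sym[OF uV[OF that(1)] uV[OF that(2)]]
      by (cases "l \<le> j"; simp)+
    have "P ?n"
      unfolding P_def
    proof (intro allI impI)
      fix i assume "i \<le> ?n"
      then show "\<exists>j\<le>N. d (u i) (c j) \<le> ?n" using ud(1)[of i 0] u0 by (intro exI[of _ 0]) auto
    qed
    then have PE: "P E" unfolding E_def by (rule LeastI)
    have key: "E \<le> D * k + 2 * D + L" if k: "M * (4 * E + 4 * D + 2) \<le> 2 ^ k" for k
    proof (cases "E = 0")
      case False
      then have "\<not> P (E - 1)" unfolding E_def using not_less_Least[of "E - 1" P] E_def by auto
      then obtain i0 where i0: "i0 \<le> ?n" and far: "\<And>j. j \<le> N \<Longrightarrow> E \<le> d (u i0) (c j)"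
      proof -
        obtain i0 where "i0 \<le> ?n" "\<And>j. j \<le> N \<Longrightarrow> \<not> d (u i0) (c j) \<le> E - 1"
          using \<open>\<not> P (E - 1)\<close> unfolding P_def by blast
        moreover from this(2) have "E \<le> d (u i0) (c j)" if "j \<le> N" for j
          using that by fastforce
        ultimately show thesis using that by blast
      qed
      define W where "W = E + 2 * D + 1"
      \<comment> \<open>Truncated subtraction and the minimum stop the walk at the ends of the geodesic.\<close>
      define l where "l = i0 - W"
      define r where "r = min ?n (i0 + W)"
      have lr: "l \<le> i0" "i0 \<le> r" "r \<le> ?n" "l \<le> ?n" using i0 by (auto simp: l_def r_def)
      \<comment> \<open>When the walk stops at an end of the geodesic, it is already on the path, so that the jump can be
        taken to be trivial; this is what excludes the side of the jump from the quadrilateral.\<close>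
      obtain jl where jl: "jl \<le> N" "d (u l) (c jl) \<le> E" "i0 \<le> W \<Longrightarrow> d (u l) (c jl) = 0"
      proof (cases "i0 \<le> W")
        case True
        then have "d (u l) (c 0) = 0" using u0 dist_self cV by (auto simp: l_def)
        then show thesis using that[of 0] by auto
      next
        case False
        then show thesis using that PE lr unfolding P_def by blast
      qed
      obtain jr where jr: "jr \<le> N" "d (u r) (c jr) \<le> E" "?n \<le> i0 + W \<Longrightarrow> d (u r) (c jr) = 0"
      proof (cases "?n \<le> i0 + W")
        case True
        then have "d (u r) (c N) = 0" using un dist_self cV by (auto simp: r_def)
        then show thesis using that[of N] by auto
      next
        case False
        then show thesis using that PE lr unfolding P_def by blast
      qed
      have V: "u l \<in> V" "u r \<in> V" "u i0 \<in> V" "c jl \<in> V" "c jr \<in> V"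
        using uV lr i0 cV jl jr by auto
      obtain a where a: "geodesic_seq V d (u l) (c jl) a" using geodesic_exists V by blast
      obtain b where b: "geodesic_seq V d (c jl) (c jr) b" using geodesic_exists V by blast
      obtain e where e: "geodesic_seq V d (c jr) (u r) e" using geodesic_exists V by blast
      have seg: "geodesic_seq V d (u l) (u r) (\<lambda>k. u (l + k))"
        using geodesic_seq_segment[OF u] lr by auto
      have dlr: "d (u l) (u r) = r - l" using geodesic_seq_dist[OF u] lr by auto
      have "\<exists>j\<le>d (c jl) (c jr). d (u i0) (b j) \<le> 2 * D"
      \<comment> \<open>If \<open>u i0\<close> is near a jump, that jump has length \<open>0\<close> and its only point is an end of \<open>b\<close>.\<close>
      proof (rule thin_quadrilateral[OF seg a b e, of "i0 - l"])
        show "i0 - l \<le> d (u l) (u r)" using lr dlr by auto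
      next
        fix j assume j: "j \<le> d (u l) (c jl)" "d (u (l + (i0 - l))) (a j) \<le> 2 * D"
        have aj: "a j \<in> V" "d (u l) (a j) = j"
          using geodesic_seq_in[OF a j(1)] geodesic_seq_dist[OF a, of 0 j] geodesic_seq_ends[OF a] j(1)
          by auto
        have j2: "d (u i0) (a j) \<le> 2 * D" using j lr by auto
        have "i0 - l \<le> d (u l) (u i0)" using ud lr i0 by auto
        also have "\<dots> \<le> d (u l) (a j) + d (a j) (u i0)" using V aj(1) by (intro dist_triangle)
        also have "\<dots> \<le> E + 2 * D" using aj j jl j2 dist_sym V by auto
        finally have "i0 \<le> W" by (auto simp: l_def W_def)
        then have "j = 0" "d (u l) (c jl) = 0" using jl j by auto
        then have "a j = b 0" using geodesic_seq_ends[OF a] geodesic_seq_ends[OF b] by auto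
        then show ?thesis using j2 by (intro exI[of _ 0]) auto
      next
        fix j assume j: "j \<le> d (c jl) (c jr)" "d (u (l + (i0 - l))) (b j) \<le> 2 * D"
        then show ?thesis using lr by auto
      next
        fix j assume j: "j \<le> d (c jr) (u r)" "d (u (l + (i0 - l))) (e j) \<le> 2 * D"
        have ej: "e j \<in> V" "d (e j) (u r) = d (c jr) (u r) - j"
          using geodesic_seq_in[OF e j(1)] geodesic_seq_dist[OF e, of j "d (c jr) (u r)"]
            geodesic_seq_ends[OF e] j(1)
          by auto
        have sym: "d (c jr) (u r) = d (u r) (c jr)" using dist_sym V by auto
        have j2: "d (u i0) (e j) \<le> 2 * D" using j lr by auto
        have "r - i0 \<le> d (u i0) (u r)" using ud lr i0 by auto
        also have "\<dots> \<le> d (u i0) (e j) + d (e j) (u r)" using V ej(1) by (intro dist_triangle)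
        also have "\<dots> \<le> E + 2 * D" using ej j jr j2 sym by auto
        finally have "?n \<le> i0 + W" by (auto simp: r_def W_def)
        then have "j = 0" "d (c jr) (u r) = 0" using jr j sym by auto
        then have "e j = b (d (c jl) (c jr))" using geodesic_seq_ends[OF e] geodesic_seq_ends[OF b] by auto
        then show ?thesis using j2 by (intro exI[of _ "d (c jl) (c jr)"]) auto
      qed
      then obtain q where q: "q \<le> d (c jl) (c jr)" "d (u i0) (b q) \<le> 2 * D" by blast
      have "d (c jl) (c jr) \<le> d (c jl) (u l) + d (u l) (c jr)" using dist_triangle V by auto
      also have "d (u l) (c jr) \<le> d (u l) (u r) + d (u r) (c jr)" using dist_triangle V by auto
      also have "d (c jl) (u l) = d (u l) (c jl)" using dist_sym V by auto
      finally have "d (c jl) (c jr) \<le> E + ((r - l) + E)" using jl jr dlr by auto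
      then have dj: "d (c jl) (c jr) \<le> 4 * E + 4 * D + 2" by (auto simp: l_def r_def W_def)
      have gap: "jr - jl \<le> 2 ^ k" "jl - jr \<le> 2 ^ k"
      proof -
        have M: "M * d (c jl) (c jr) \<le> 2 ^ k" using dj k mult_le_mono2 order_trans by blast
        have sym: "d (c jl) (c jr) = d (c jr) (c jl)" using dist_sym V by auto
        show "jr - jl \<le> 2 ^ k"
          using quasi[rule_format, of jl jr] jr(1) M by (cases "jl \<le> jr") auto
        show "jl - jr \<le> 2 ^ k"
          using quasi[rule_format, of jr jl] jl(1) M sym by (cases "jr \<le> jl") auto
      qed
      have "\<exists>j\<le>N. d (b q) (c j) \<le> D * k + L"
        using cV step by (intro geodesic_near_subpath_log[OF _ _ jl(1) jr(1) gap b q(1)]) auto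
      then obtain j where j: "j \<le> N" "d (b q) (c j) \<le> D * k + L" by blast
      have "E \<le> d (u i0) (c j)" using far j by auto
      also have "\<dots> \<le> d (u i0) (b q) + d (b q) (c j)"
        using dist_triangle V geodesic_seq_in[OF b q(1)] cV j by auto
      finally show ?thesis using q j by linarith
    qed simp
    define Q where "Q k \<longleftrightarrow> M * (4 * E + 4 * D + 2) \<le> 2 ^ k" for k
    have "\<exists>k. Q k" unfolding Q_def using less_exp less_imp_le by blast
    then have Qk: "Q (LEAST k. Q k)" by (metis LeastI)
    have "E \<le> R"
    \<comment> \<open>Just below the least admissible exponent the number of steps exceeds the power of two, which is
      incompatible with the logarithmic bound on \<open>E\<close> from \<open>k0\<close> on.\<close>
    proof (cases "(LEAST k. Q k) \<le> k0")
      case True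
      have "E \<le> D * (LEAST k. Q k) + 2 * D + L" using key Qk unfolding Q_def by blast
      also have "\<dots> \<le> R" unfolding R_def using True by auto
      finally show ?thesis .
    next
      case False
      then obtain k where k: "(LEAST k. Q k) = Suc k" "k0 \<le> k"
        by (metis Suc_leI not_less_eq_eq Suc_le_D le_SucE nat_le_linear)
      have "\<not> Q k" using k(1) not_less_Least[of k Q] by auto
      have "E \<le> D * Suc k + 2 * D + L" using key[of "Suc k"] Qk k unfolding Q_def by auto
      then have "M * (4 * E + 4 * D + 2) \<le> M * (4 * (D * Suc k + 2 * D + L) + 4 * D + 2)"
        by (intro mult_le_mono2) auto
      also have "\<dots> = (4 * M * D) * k + M * (16 * D + 4 * L + 2)" by (simp add: algebra_simps)
      also have "\<dots> \<le> 2 ^ k" using k0 k by auto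
      finally show ?thesis using \<open>\<not> Q k\<close> unfolding Q_def by auto
    qed
    then show ?thesis using PE i unfolding P_def by (meson order_trans)
  qed
  then show ?thesis by blast
qed

end

section \<open>Word metrics\<close>

locale finitely_generated_group = group G for G :: "('a, 'b) monoid_scheme" (structure) +
  fixes X :: "'a set"
  assumes generating: "finite_generating_set G X"
begin

definition letters :: "'a set" where
  "letters = X \<union> m_inv G ` X"

definition eval_word :: "'a list \<Rightarrow> 'a" where
  "eval_word xs = foldr (\<otimes>) xs \<one>"

abbreviation word_dist :: "'a \<Rightarrow> 'a \<Rightarrow> nat" where
  "word_dist \<equiv> vertex_dist (cayley_graph G X)"

lemma letters_closed: "letters \<subseteq> carrier G"
  and finite_letters: "finite letters"
  using generating by (auto simp: letters_def finite_generating_set_def)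

lemma inv_letters: "s \<in> letters \<Longrightarrow> inv s \<in> letters"
  using generating by (auto simp: letters_def finite_generating_set_def)

lemma eval_word_Nil [simp]: "eval_word [] = \<one>"
  and eval_word_Cons [simp]: "eval_word (x # xs) = x \<otimes> eval_word xs"
  by (simp_all add: eval_word_def)

lemma eval_word_closed [simp]: "set xs \<subseteq> letters \<Longrightarrow> eval_word xs \<in> carrier G"
  using letters_closed by (induction xs) auto

lemma eval_word_append:
  "set xs \<subseteq> letters \<Longrightarrow> set ys \<subseteq> letters \<Longrightarrow> eval_word (xs @ ys) = eval_word xs \<otimes> eval_word ys"
  using letters_closed by (induction xs) (auto simp: m_assoc subset_iff)

lemma inv_eval_word:
  "set xs \<subseteq> letters \<Longrightarrow> inv (eval_word xs) = eval_word (rev (map (m_inv G) xs))"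
proof (induction xs)
  case (Cons x xs)
  then have "x \<in> carrier G" "inv x \<in> letters" using letters_closed inv_letters by auto
  moreover have "set (rev (map (m_inv G) xs)) \<subseteq> letters" using Cons inv_letters by auto
  ultimately show ?case using Cons letters_closed by (auto simp: inv_mult_group eval_word_append)
qed simp

lemma ex_word:
  assumes "g \<in> carrier G"
  shows "\<exists>xs. set xs \<subseteq> letters \<and> eval_word xs = g"
proof -
  have X: "X \<subseteq> carrier G" "g \<in> generate G X"
    using assms generating by (auto simp: finite_generating_set_def)
  from X(2) show ?thesis
  proof (induction rule: generate.induct)
    case one
    show ?case by (rule exI[of _ "[]"]) auto
  next
    case (incl h)
    then show ?case using X(1) by (intro exI[of _ "[h]"]) (auto simp: letters_def)
  next
    case (inv h)
    then show ?case using X(1) by (intro exI[of _ "[inv h]"]) (auto simp: letters_def)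
  next
    case (eng h1 h2)
    then obtain xs ys where "set xs \<subseteq> letters" "eval_word xs = h1" "set ys \<subseteq> letters" "eval_word ys = h2"
      by blast
    then show ?case by (intro exI[of _ "xs @ ys"]) (auto simp: eval_word_append)
  qed
qed

text \<open>
  The link between walks in the Cayley graph and words, through which the word metric inherits
  everything from concatenation and formal inversion of words.
\<close>

lemma awalk_cayley_graph_iff:
  assumes "u \<in> carrier G"
  shows "(\<exists>p. pre_digraph.awalk (cayley_graph G X) u p v \<and> length p = n) \<longleftrightarrow>
    (\<exists>xs. set xs \<subseteq> letters \<and> length xs = n \<and> v = u \<otimes> eval_word xs)"
  using assms
proof (induction n arbitrary: u)
  case 0
  then show ?case
    by (auto simp: pre_digraph.awalk_def pre_digraph.cas.simps cayley_graph_def)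
next
  case (Suc n)
  let ?\<Gamma> = "cayley_graph G X"
  have "(\<exists>p. pre_digraph.awalk ?\<Gamma> u p v \<and> length p = Suc n) \<longleftrightarrow>
      (\<exists>s\<in>letters. \<exists>p. pre_digraph.awalk ?\<Gamma> (u \<otimes> s) p v \<and> length p = n)"
  proof
    assume "\<exists>p. pre_digraph.awalk ?\<Gamma> u p v \<and> length p = Suc n"
    then obtain e p where p: "pre_digraph.awalk ?\<Gamma> u (e # p) v" "length p = n"
      by (metis length_Suc_conv)
    then show "\<exists>s\<in>letters. \<exists>p. pre_digraph.awalk ?\<Gamma> (u \<otimes> s) p v \<and> length p = n"
      using letters_closed
      by (intro bexI[of _ "snd e"] exI[of _ p])
         (auto simp: pre_digraph.awalk_def pre_digraph.cas.simps cayley_graph_def letters_def)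
  next
    assume "\<exists>s\<in>letters. \<exists>p. pre_digraph.awalk ?\<Gamma> (u \<otimes> s) p v \<and> length p = n"
    then obtain s p where "s \<in> letters" "pre_digraph.awalk ?\<Gamma> (u \<otimes> s) p v" "length p = n" by blast
    then show "\<exists>p. pre_digraph.awalk ?\<Gamma> u p v \<and> length p = Suc n"
      using Suc.prems
      by (intro exI[of _ "(u, s) # p"])
         (auto simp: pre_digraph.awalk_def pre_digraph.cas.simps cayley_graph_def letters_def)
  qed
  also have "\<dots> \<longleftrightarrow> (\<exists>s\<in>letters. \<exists>xs. set xs \<subseteq> letters \<and> length xs = n \<and> v = u \<otimes> s \<otimes> eval_word xs)"
    using Suc letters_closed by (intro bex_cong refl Suc.IH) auto
  also have "\<dots> \<longleftrightarrow> (\<exists>xs. set xs \<subseteq> letters \<and> length xs = Suc n \<and> v = u \<otimes> eval_word xs)"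
  proof
    assume "\<exists>s\<in>letters. \<exists>xs. set xs \<subseteq> letters \<and> length xs = n \<and> v = u \<otimes> s \<otimes> eval_word xs"
    then obtain s xs where "s \<in> letters" "set xs \<subseteq> letters" "length xs = n" "v = u \<otimes> s \<otimes> eval_word xs"
      by blast
    then show "\<exists>xs. set xs \<subseteq> letters \<and> length xs = Suc n \<and> v = u \<otimes> eval_word xs"
      using Suc.prems letters_closed by (intro exI[of _ "s # xs"]) (auto simp: m_assoc)
  next
    assume "\<exists>xs. set xs \<subseteq> letters \<and> length xs = Suc n \<and> v = u \<otimes> eval_word xs"
    then obtain s xs where "s \<in> letters" "set xs \<subseteq> letters" "length xs = n"
      "v = u \<otimes> (s \<otimes> eval_word xs)"
      by (auto simp: length_Suc_conv)
    then show "\<exists>s\<in>letters. \<exists>xs. set xs \<subseteq> letters \<and> length xs = n \<and> v = u \<otimes> s \<otimes> eval_word xs"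
      using Suc.prems letters_closed by (intro bexI[of _ s] exI[of _ xs]) (auto simp: m_assoc)
  qed
  finally show ?case .
qed

lemma word_dist_eq_Least:
  assumes "u \<in> carrier G"
  shows "word_dist u v = (LEAST n. \<exists>xs. set xs \<subseteq> letters \<and> length xs = n \<and> v = u \<otimes> eval_word xs)"
  unfolding vertex_dist_def awalk_cayley_graph_iff[OF assms] ..

lemma word_dist_le:
  assumes "u \<in> carrier G" "set xs \<subseteq> letters"
  shows "word_dist u (u \<otimes> eval_word xs) \<le> length xs"
  unfolding word_dist_eq_Least[OF assms(1)] using assms by (intro Least_le) auto

lemma word_dist_word:
  assumes "u \<in> carrier G" "v \<in> carrier G"
  obtains xs where "set xs \<subseteq> letters" "length xs = word_dist u v" "v = u \<otimes> eval_word xs"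
proof -
  obtain xs where "set xs \<subseteq> letters" "eval_word xs = inv u \<otimes> v" using ex_word assms by blast
  then have "\<exists>n xs. set xs \<subseteq> letters \<and> length xs = n \<and> v = u \<otimes> eval_word xs"
    using assms by (auto simp: m_assoc[symmetric])
  from LeastI_ex[OF this] show thesis
    unfolding word_dist_eq_Least[OF assms(1), symmetric] using that by blast
qed

lemma word_dist_self: "u \<in> carrier G \<Longrightarrow> word_dist u u = 0"
  using word_dist_le[of u "[]"] by simp

lemma word_dist_sym_le:
  assumes "u \<in> carrier G" "v \<in> carrier G"
  shows "word_dist v u \<le> word_dist u v"
proof -
  obtain xs where xs: "set xs \<subseteq> letters" "length xs = word_dist u v" "v = u \<otimes> eval_word xs"
    using word_dist_word assms by blast
  let ?ys = "rev (map (m_inv G) xs)"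
  have "v \<otimes> eval_word ?ys = u"
    using xs assms by (simp add: inv_eval_word[symmetric] m_assoc)
  moreover have "set ?ys \<subseteq> letters" using xs inv_letters by auto
  ultimately show ?thesis using word_dist_le[of v ?ys] assms xs by simp
qed

lemma word_dist_triangle:
  assumes "u \<in> carrier G" "v \<in> carrier G" "w \<in> carrier G"
  shows "word_dist u w \<le> word_dist u v + word_dist v w"
proof -
  obtain xs where xs: "set xs \<subseteq> letters" "length xs = word_dist u v" "v = u \<otimes> eval_word xs"
    using word_dist_word assms by blast
  obtain ys where ys: "set ys \<subseteq> letters" "length ys = word_dist v w" "w = v \<otimes> eval_word ys"
    using word_dist_word assms by blast
  have "w = u \<otimes> eval_word (xs @ ys)" using xs ys assms by (simp add: eval_word_append m_assoc)
  then show ?thesis using word_dist_le[of u "xs @ ys"] xs ys assms by simp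
qed

lemma word_dist_translate_le:
  assumes "g \<in> carrier G" "u \<in> carrier G" "v \<in> carrier G"
  shows "word_dist (g \<otimes> u) (g \<otimes> v) \<le> word_dist u v"
proof -
  obtain xs where xs: "set xs \<subseteq> letters" "length xs = word_dist u v" "v = u \<otimes> eval_word xs"
    using word_dist_word assms by blast
  then show ?thesis using word_dist_le[of "g \<otimes> u" xs] assms by (simp add: m_assoc)
qed

lemma word_dist_translate:
  assumes "g \<in> carrier G" "u \<in> carrier G" "v \<in> carrier G"
  shows "word_dist (g \<otimes> u) (g \<otimes> v) = word_dist u v"
  using word_dist_translate_le[OF assms] word_dist_translate_le[of "inv g" "g \<otimes> u" "g \<otimes> v"] assms
  by (simp add: m_assoc[symmetric])

text \<open>
  The prefixes of a shortest word trace a geodesic: a shortcut between two of them would shorten the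
  word.
\<close>

lemma ex_geodesic_seq:
  assumes "u \<in> carrier G" "v \<in> carrier G"
  shows "\<exists>c. geodesic_seq (carrier G) word_dist u v c"
proof -
  obtain xs where xs: "set xs \<subseteq> letters" "length xs = word_dist u v" "v = u \<otimes> eval_word xs"
    using word_dist_word assms by blast
  let ?n = "word_dist u v"
  define c where "c i = u \<otimes> eval_word (take i xs)" for i
  have sub: "set (take i xs) \<subseteq> letters" "set (drop i xs) \<subseteq> letters" for i
    using xs set_take_subset set_drop_subset by fast+
  have cV: "c i \<in> carrier G" for i unfolding c_def using assms sub by auto
  have le: "word_dist (c i) (c j) \<le> j - i" if "i \<le> j" "j \<le> ?n" for i j
  proof -
    let ?m = "take (j - i) (drop i xs)"
    have m: "set ?m \<subseteq> letters" using sub(2)[of i] set_take_subset by fast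
    have "take j xs = take i xs @ ?m" using that by (metis le_add_diff_inverse take_add)
    then have "c j = c i \<otimes> eval_word ?m"
      unfolding c_def using m sub assms by (simp add: eval_word_append m_assoc)
    then show ?thesis using word_dist_le[OF cV m, of i] that xs by simp
  qed
  have ends: "c 0 = u" "c ?n = v" unfolding c_def using xs assms by auto
  have "word_dist (c i) (c j) = j - i" if "i \<le> j" "j \<le> ?n" for i j
  proof -
    have "word_dist (c 0) (c ?n) \<le> word_dist (c 0) (c i) + word_dist (c i) (c ?n)"
      "word_dist (c i) (c ?n) \<le> word_dist (c i) (c j) + word_dist (c j) (c ?n)"
      using cV by (intro word_dist_triangle; simp)+
    then show ?thesis using le[of 0 i] le[of i j] le[of j ?n] that ends by simp
  qed
  then show ?thesis using ends cV by (auto simp: geodesic_seq_def)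
qed

sublocale word: geodesic_space "carrier G" word_dist
  using word_dist_self word_dist_sym_le word_dist_triangle ex_geodesic_seq
  by unfold_locales (auto intro: antisym)

lemma finite_word_ball: "finite {g \<in> carrier G. word_dist \<one> g \<le> r}"
proof (rule finite_subset)
  show "{g \<in> carrier G. word_dist \<one> g \<le> r} \<subseteq> eval_word ` {xs. set xs \<subseteq> letters \<and> length xs \<le> r}"
  proof
    fix g assume "g \<in> {g \<in> carrier G. word_dist \<one> g \<le> r}"
    then show "g \<in> eval_word ` {xs. set xs \<subseteq> letters \<and> length xs \<le> r}"
      using word_dist_word[of \<one> g] by (metis (mono_tags, lifting) eval_word_closed image_eqI l_one
          mem_Collect_eq one_closed)
  qed
  show "finite (eval_word ` {xs. set xs \<subseteq> letters \<and> length xs \<le> r})"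
    using finite_lists_length_le[OF finite_letters] by simp
qed

lemma geodesic_seq_translate:
  assumes "g \<in> carrier G" "geodesic_seq (carrier G) word_dist x y u"
  shows "geodesic_seq (carrier G) word_dist (g \<otimes> x) (g \<otimes> y) (\<lambda>i. g \<otimes> u i)"
  using assms word.geodesic_seq_ends[OF assms(2)]
  by (auto simp: geodesic_seq_def word_dist_translate)

end

text \<open>
  The constant is the largest length of a letter of the one generating set with respect to the other.
\<close>

lemma word_dist_lipschitz:
  assumes X: "finitely_generated_group G X" and Y: "finitely_generated_group G Y"
  shows "\<exists>L. \<forall>a\<in>carrier G. \<forall>b\<in>carrier G.
    vertex_dist (cayley_graph G Y) a b \<le> L * vertex_dist (cayley_graph G X) a b"
proof -
  interpret X: finitely_generated_group G X by fact
  interpret Y: finitely_generated_group G Y by fact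
  define L where "L = Max (Y.word_dist \<one>\<^bsub>G\<^esub> ` X.letters)"
  have "Y.word_dist a (a \<otimes>\<^bsub>G\<^esub> X.eval_word xs) \<le> L * length xs"
    if "set xs \<subseteq> X.letters" "a \<in> carrier G" for a xs
    using that
  proof (induction xs arbitrary: a)
    case Nil
    then show ?case using Y.word_dist_self by simp
  next
    case (Cons s xs)
    then have s: "s \<in> carrier G" "s \<in> X.letters" "X.eval_word xs \<in> carrier G"
      using X.letters_closed by auto
    let ?as = "a \<otimes>\<^bsub>G\<^esub> s"
    have eq: "a \<otimes>\<^bsub>G\<^esub> X.eval_word (s # xs) = ?as \<otimes>\<^bsub>G\<^esub> X.eval_word xs"
      using Cons.prems s by (simp add: X.m_assoc)
    have "Y.word_dist a (?as \<otimes>\<^bsub>G\<^esub> X.eval_word xs)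
        \<le> Y.word_dist a ?as + Y.word_dist ?as (?as \<otimes>\<^bsub>G\<^esub> X.eval_word xs)"
      using Cons.prems s by (intro Y.word_dist_triangle) auto
    moreover have "Y.word_dist a ?as = Y.word_dist \<one>\<^bsub>G\<^esub> s"
      using Y.word_dist_translate[of a "\<one>\<^bsub>G\<^esub>" s] Cons.prems s by simp
    moreover have "Y.word_dist \<one>\<^bsub>G\<^esub> s \<le> L"
      unfolding L_def using X.finite_letters s by (intro Max_ge) auto
    moreover have "Y.word_dist ?as (?as \<otimes>\<^bsub>G\<^esub> X.eval_word xs) \<le> L * length xs"
      using Cons s by (intro Cons.IH) auto
    ultimately show ?case unfolding eq by simp
  qed
  then show ?thesis by (metis X.word_dist_word)
qed

section \<open>Geodesics in the Cayley graph\<close>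

lemma finite_inner_lengths: "finite (inner_lengths p q)"
  by (cases "(p, q)" rule: inner_lengths.cases) auto

lemma finite_exits: "finite (exits \<Gamma> p)"
  by (cases p) auto

context finitely_generated_group
begin

text \<open>
  The polygonal path through the vertices \<open>u 0, u 1, \<dots>\<close>, parametrized by arc length: at a natural
  time it is at a vertex, otherwise on the arc labelled by the quotient of two consecutive vertices.
\<close>

definition trace :: "(nat \<Rightarrow> 'a) \<Rightarrow> real \<Rightarrow> ('a, 'a \<times> 'a) point" where
  "trace u t = (let k = nat \<lfloor>t\<rfloor> in
     if t = real k then Vertex (u k) else Inner (u k, inv (u k) \<otimes> u (Suc k)) (t - real k))"

lemma trace_of_nat [simp]: "trace u (real k) = Vertex (u k)"
  by (simp add: trace_def)

lemma geodesic_seq_step: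
  assumes "geodesic_seq (carrier G) word_dist x y u" "Suc k \<le> word_dist x y"
  shows "inv (u k) \<otimes> u (Suc k) \<in> letters" "u k \<otimes> (inv (u k) \<otimes> u (Suc k)) = u (Suc k)"
proof -
  have V: "u k \<in> carrier G" "u (Suc k) \<in> carrier G"
    using word.geodesic_seq_in[OF assms(1)] assms(2) by auto
  have "word_dist (u k) (u (Suc k)) = 1"
    using word.geodesic_seq_dist[OF assms(1), of k "Suc k"] assms(2) by simp
  then obtain xs where xs: "set xs \<subseteq> letters" "length xs = 1" "u (Suc k) = u k \<otimes> eval_word xs"
    using word_dist_word[OF V] by metis
  then obtain s where "xs = [s]" by (auto simp: length_Suc_conv)
  then have "s \<in> letters" "u (Suc k) = u k \<otimes> s" "s \<in> carrier G" using xs letters_closed by auto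
  then show "inv (u k) \<otimes> u (Suc k) \<in> letters" "u k \<otimes> (inv (u k) \<otimes> u (Suc k)) = u (Suc k)"
    using V by (simp_all add: m_assoc[symmetric])
qed

lemma trace_cases:
  assumes u: "geodesic_seq (carrier G) word_dist x y u" and t: "t \<in> {0..real (word_dist x y)}"
  obtains (vertex) k where "t = real k" "k \<le> word_dist x y"
  | (inner) k where "real k < t" "t < real k + 1" "Suc k \<le> word_dist x y" "nat \<lfloor>t\<rfloor> = k"
      "nat \<lceil>t\<rceil> = Suc k" "trace u t = Inner (u k, inv (u k) \<otimes> u (Suc k)) (t - real k)"
proof -
  define k where "k = nat \<lfloor>t\<rfloor>"
  have k: "real k \<le> t" "t < real k + 1" using t unfolding k_def by (auto simp: floor_less_iff)
  show thesis
  proof (cases "t = real k")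
    case True
    then show thesis using vertex t by auto
  next
    case False
    then have "real k < t" using k by auto
    moreover from this have "Suc k \<le> word_dist x y" using t by (auto simp: Suc_le_eq)
    moreover have "nat \<lceil>t\<rceil> = Suc k" using k \<open>real k < t\<close> by (simp add: ceiling_eq_iff nat_eq_iff)
    moreover have "trace u t = Inner (u k, inv (u k) \<otimes> u (Suc k)) (t - real k)"
      using False by (simp add: trace_def Let_def flip: k_def)
    ultimately show thesis using inner k(2) k_def by blast
  qed
qed

lemma trace_in_points:
  assumes "geodesic_seq (carrier G) word_dist x y u" "t \<in> {0..real (word_dist x y)}"
  shows "trace u t \<in> points (cayley_graph G X)"
  using assms(1,2)
proof (cases rule: trace_cases)
  case (vertex k)
  then show ?thesis
    using word.geodesic_seq_in[OF assms(1)] by (auto simp: points_def cayley_graph_def)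
next
  case (inner k)
  then show ?thesis
    using geodesic_seq_step[OF assms(1)] word.geodesic_seq_in[OF assms(1), of k]
    by (auto simp: points_def cayley_graph_def letters_def)
qed

text \<open>
  A uniform description for vertices and inner points: one leaves \<open>trace u t\<close> through the vertices at
  the times \<open>t\<close> rounded down and up, which coincide at a vertex.
\<close>

lemma exits_trace:
  assumes u: "geodesic_seq (carrier G) word_dist x y u" and t: "t \<in> {0..real (word_dist x y)}"
  shows "exits (cayley_graph G X) (trace u t) =
    (\<lambda>k. (u k, \<bar>t - real k\<bar>)) ` {nat \<lfloor>t\<rfloor>, nat \<lceil>t\<rceil>}"
  using u t
proof (cases rule: trace_cases)
  case (vertex k)
  then show ?thesis by simp
next
  case (inner k)
  then show ?thesis
    using geodesic_seq_step[OF u] by (auto simp: cayley_graph_def)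
qed

lemma word_dist_geodesic_seq:
  assumes "geodesic_seq (carrier G) word_dist x y u" "i \<le> word_dist x y" "j \<le> word_dist x y"
  shows "real (word_dist (u i) (u j)) = \<bar>real i - real j\<bar>"
proof (cases "i \<le> j")
  case True
  then show ?thesis using word.geodesic_seq_dist[OF assms(1)] assms by simp
next
  case False
  then show ?thesis
    using word.geodesic_seq_dist[OF assms(1), of j i] assms
      word.dist_sym[of "u i" "u j"] word.geodesic_seq_in[OF assms(1)] by simp
qed

text \<open>
  Every connection that leaves the arcs runs through two times \<open>i\<close> and \<open>j\<close> and has length
  \<open>\<bar>s - i\<bar> + \<bar>i - j\<bar> + \<bar>t - j\<bar>\<close>, which is at least \<open>\<bar>s - t\<bar>\<close>. Equality is reached by rounding both times
  towards each other, unless both lie in the interior of one arc, where the direct connection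
  reaches it.
\<close>

lemma pdist_trace:
  assumes u: "geodesic_seq (carrier G) word_dist x y u"
    and s: "s \<in> {0..real (word_dist x y)}" and t: "t \<in> {0..real (word_dist x y)}"
  shows "pdist (cayley_graph G X) (trace u s) (trace u t) = \<bar>s - t\<bar>"
proof -
  let ?\<Gamma> = "cayley_graph G X" and ?n = "word_dist x y"
  let ?via = "(\<lambda>((a, r), (b, r')). r + real (word_dist a b) + r') `
    (exits ?\<Gamma> (trace u s) \<times> exits ?\<Gamma> (trace u t))"
  have dist: "real (word_dist (u i) (u j)) = \<bar>real i - real j\<bar>" if "i \<le> ?n" "j \<le> ?n" for i j
    using word_dist_geodesic_seq[OF u that] .
  have rng: "nat \<lfloor>r\<rfloor> \<le> ?n" "nat \<lceil>r\<rceil> \<le> ?n" "0 \<le> \<lfloor>r\<rfloor>" "0 \<le> \<lceil>r\<rceil>"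
    if "r \<in> {0..real ?n}" for r :: real
    using that by (auto simp: nat_le_iff ceiling_le_iff floor_le_iff)
  \<comment> \<open>Turn the set in the definition of the path metric into a set of detours on the real line.\<close>
  have via: "?via = {\<bar>s - real i\<bar> + \<bar>real i - real j\<bar> + \<bar>t - real j\<bar> | i j.
      i \<in> {nat \<lfloor>s\<rfloor>, nat \<lceil>s\<rceil>} \<and> j \<in> {nat \<lfloor>t\<rfloor>, nat \<lceil>t\<rceil>}}" (is "_ = ?via'")
  proof -
    have "?via = (\<lambda>(i, j). \<bar>s - real i\<bar> + real (word_dist (u i) (u j)) + \<bar>t - real j\<bar>) `
        ({nat \<lfloor>s\<rfloor>, nat \<lceil>s\<rceil>} \<times> {nat \<lfloor>t\<rfloor>, nat \<lceil>t\<rceil>})"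
      unfolding exits_trace[OF u s] exits_trace[OF u t] by auto
    also have "\<dots> = (\<lambda>(i, j). \<bar>s - real i\<bar> + \<bar>real i - real j\<bar> + \<bar>t - real j\<bar>) `
        ({nat \<lfloor>s\<rfloor>, nat \<lceil>s\<rceil>} \<times> {nat \<lfloor>t\<rfloor>, nat \<lceil>t\<rceil>})"
      using rng[OF s] rng[OF t] by (intro image_cong refl) (auto simp: dist)
    also have "\<dots> = ?via'" by auto
    finally show ?thesis .
  qed
  have inner: "inner_lengths (trace u s) (trace u t) \<subseteq> {\<bar>s - t\<bar>}"
    using u s
  proof (cases rule: trace_cases)
    case (inner k)
    note k = this
    from u t show ?thesis
    proof (cases rule: trace_cases)
      case (inner l)
      have "k = l" if "u k = u l"
        using dist[of k l] that k inner word.dist_self[of "u k"] word.geodesic_seq_in[OF u, of k]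
        by simp
      then show ?thesis using k inner by auto
    qed auto
  qed auto
  have "pdist ?\<Gamma> (trace u s) (trace u t) = Min (inner_lengths (trace u s) (trace u t) \<union> ?via)"
    unfolding pdist_def ..
  also have "\<dots> = \<bar>s - t\<bar>"
  proof (rule Min_eqI)
    show "finite (inner_lengths (trace u s) (trace u t) \<union> ?via)"
      by (intro finite_UnI finite_imageI finite_cartesian_product finite_inner_lengths finite_exits)
    show "\<bar>s - t\<bar> \<le> r" if "r \<in> inner_lengths (trace u s) (trace u t) \<union> ?via" for r
    proof -
      have "r = \<bar>s - t\<bar> \<or> (\<exists>i j. r = \<bar>s - real i\<bar> + \<bar>real i - real j\<bar> + \<bar>t - real j\<bar>)"
        using that inner unfolding via by blast
      then show ?thesis by (elim disjE exE) linarith+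
    qed
    consider "\<lceil>s\<rceil> \<le> \<lfloor>t\<rfloor>" | "\<lceil>t\<rceil> \<le> \<lfloor>s\<rfloor>" | "\<lfloor>s\<rfloor> = \<lfloor>t\<rfloor>" "\<lfloor>s\<rfloor> < \<lceil>s\<rceil>" "\<lfloor>t\<rfloor> < \<lceil>t\<rceil>"
      using floor_le_ceiling[of s] floor_le_ceiling[of t] ceiling_altdef[of s] ceiling_altdef[of t]
      by (smt (verit))
    then show "\<bar>s - t\<bar> \<in> inner_lengths (trace u s) (trace u t) \<union> ?via"
    proof cases
      case 1
      have "s \<le> real (nat \<lceil>s\<rceil>)" by (rule real_nat_ceiling_ge)
      moreover have "real (nat \<lceil>s\<rceil>) \<le> real (nat \<lfloor>t\<rfloor>)"
        using nat_mono[OF 1] of_nat_mono by blast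
      moreover have "real (nat \<lfloor>t\<rfloor>) \<le> t" using t by (intro of_nat_floor) simp
      ultimately have "\<bar>s - t\<bar> = \<bar>s - real (nat \<lceil>s\<rceil>)\<bar> + \<bar>real (nat \<lceil>s\<rceil>) - real (nat \<lfloor>t\<rfloor>)\<bar> + \<bar>t - real (nat \<lfloor>t\<rfloor>)\<bar>"
        by linarith
      then show ?thesis unfolding via by blast
    next
      case 2
      have "t \<le> real (nat \<lceil>t\<rceil>)" by (rule real_nat_ceiling_ge)
      moreover have "real (nat \<lceil>t\<rceil>) \<le> real (nat \<lfloor>s\<rfloor>)"
        using nat_mono[OF 2] of_nat_mono by blast
      moreover have "real (nat \<lfloor>s\<rfloor>) \<le> s" using s by (intro of_nat_floor) simp
      ultimately have "\<bar>s - t\<bar> = \<bar>s - real (nat \<lfloor>s\<rfloor>)\<bar> + \<bar>real (nat \<lfloor>s\<rfloor>) - real (nat \<lceil>t\<rceil>)\<bar> + \<bar>t - real (nat \<lceil>t\<rceil>)\<bar>"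
        by linarith
      then show ?thesis unfolding via by blast
    next
      case 3
      have "s \<noteq> real k" "t \<noteq> real k" for k using 3 by auto
      with 3 have "inner_lengths (trace u s) (trace u t) = {\<bar>s - t\<bar>}" by (auto simp: trace_def Let_def)
      then show ?thesis by simp
    qed
  qed
  finally show ?thesis .
qed

lemma geodesic_trace:
  assumes u: "geodesic_seq (carrier G) word_dist x y u"
  shows "geodesic (cayley_graph G X) (Vertex x) (Vertex y) (trace u ` {0..real (word_dist x y)})"
  unfolding geodesic_def
proof (intro exI conjI ballI)
  show "trace u 0 = Vertex x" using trace_of_nat[of u 0] word.geodesic_seq_ends[OF u] by simp
  show "trace u (real (word_dist x y)) = Vertex y" using word.geodesic_seq_ends[OF u] by simp
  show "trace u ` {0..real (word_dist x y)} \<subseteq> points (cayley_graph G X)"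
    using trace_in_points[OF u] by auto
qed (use pdist_trace[OF u] in auto)

text \<open>
  A path from a vertex to a point of the trace enters the arc of that point through one of its ends,
  which is a vertex of the geodesic and is reached even earlier.
\<close>

lemma pdist_vertex_trace:
  assumes u: "geodesic_seq (carrier G) word_dist x y u" and t: "t \<in> {0..real (word_dist x y)}"
    and le: "pdist (cayley_graph G X) (Vertex a) (trace u t) \<le> r"
  shows "\<exists>k\<le>word_dist x y. real (word_dist a (u k)) \<le> r"
proof -
  let ?\<Gamma> = "cayley_graph G X"
  let ?via = "(\<lambda>((a, r), (b, r')). r + real (word_dist a b) + r') `
    (exits ?\<Gamma> (Vertex a) \<times> exits ?\<Gamma> (trace u t))"
  have "finite ?via" by (intro finite_imageI finite_cartesian_product finite_exits)
  moreover have "?via \<noteq> {}" unfolding exits_trace[OF u t] by auto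
  moreover have "pdist ?\<Gamma> (Vertex a) (trace u t) = Min ?via" unfolding pdist_def by simp
  ultimately have "pdist ?\<Gamma> (Vertex a) (trace u t) \<in> ?via" using Min_in by auto
  then obtain k where k: "k \<in> {nat \<lfloor>t\<rfloor>, nat \<lceil>t\<rceil>}"
    "pdist ?\<Gamma> (Vertex a) (trace u t) = real (word_dist a (u k)) + \<bar>t - real k\<bar>"
    unfolding exits_trace[OF u t] by auto
  have "k \<le> word_dist x y" using k t by (auto simp: nat_le_iff ceiling_le_iff floor_le_iff)
  then show ?thesis using k le by (intro exI[of _ k]) auto
qed

text \<open>
  Passing from the geometric realization to vertices does not worsen the constant, since a vertex
  that is \<open>\<delta>\<close>-close to a side is \<open>\<delta>\<close>-close to a vertex of that side.
\<close>

lemma thin_space_word_dist: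
  assumes "thin_triangles (cayley_graph G X) \<delta>"
  shows "thin_space (carrier G) word_dist (nat \<lfloor>\<delta>\<rfloor>)"
proof unfold_locales
  fix x y z u v w i
  assume u: "geodesic_seq (carrier G) word_dist x y u" and v: "geodesic_seq (carrier G) word_dist x z v"
    and w: "geodesic_seq (carrier G) word_dist z y w" and i: "i \<le> word_dist x y"
  define v' w' where "v' = (\<lambda>i. v (word_dist x z - i))" and "w' = (\<lambda>i. w (word_dist z y - i))"
  have v': "geodesic_seq (carrier G) word_dist z x v'"
    and w': "geodesic_seq (carrier G) word_dist y z w'"
    unfolding v'_def w'_def using word.geodesic_seq_rev u v w by auto
  let ?A = "trace u ` {0..real (word_dist x y)}" and ?B = "trace w' ` {0..real (word_dist y z)}"
    and ?C = "trace v' ` {0..real (word_dist z x)}"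
  have "?A \<subseteq> neighborhood (cayley_graph G X) \<delta> (?B \<union> ?C)"
    using assms geodesic_trace[OF u] geodesic_trace[OF w'] geodesic_trace[OF v']
    unfolding thin_triangles_def by blast
  moreover have "Vertex (u i) \<in> ?A" using i by (intro image_eqI[of _ _ "real i"]) auto
  ultimately obtain p where p: "p \<in> ?B \<union> ?C" "pdist (cayley_graph G X) (Vertex (u i)) p \<le> \<delta>"
  proof -
    assume sub: "?A \<subseteq> neighborhood (cayley_graph G X) \<delta> (?B \<union> ?C)" and mem: "Vertex (u i) \<in> ?A"
    have "Vertex (u i) \<in> neighborhood (cayley_graph G X) \<delta> (?B \<union> ?C)" using sub mem by (rule subsetD)
    then show thesis using that unfolding neighborhood_def by (elim CollectE conjE bexE)
  qed
  from p(1) show "(\<exists>j\<le>word_dist x z. word_dist (u i) (v j) \<le> nat \<lfloor>\<delta>\<rfloor>) \<or>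
    (\<exists>j\<le>word_dist z y. word_dist (u i) (w j) \<le> nat \<lfloor>\<delta>\<rfloor>)"
  proof
    assume "p \<in> ?B"
    then obtain k where "real (word_dist (u i) (w' k)) \<le> \<delta>"
      using pdist_vertex_trace[OF w'] p(2) by blast
    then have "word_dist (u i) (w (word_dist z y - k)) \<le> nat \<lfloor>\<delta>\<rfloor>"
      unfolding w'_def by (rule le_nat_floor)
    then show ?thesis by (meson diff_le_self)
  next
    assume "p \<in> ?C"
    then obtain k where "real (word_dist (u i) (v' k)) \<le> \<delta>"
      using pdist_vertex_trace[OF v'] p(2) by blast
    then have "word_dist (u i) (v (word_dist x z - k)) \<le> nat \<lfloor>\<delta>\<rfloor>"
      unfolding v'_def by (rule le_nat_floor)
    then show ?thesis by (meson diff_le_self)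
  qed
qed

text \<open>
  Quasiconvexity seen on vertices alone, with a natural number as constant.
\<close>

definition quasiconvex_within :: "nat \<Rightarrow> 'a set \<Rightarrow> bool" where
  "quasiconvex_within R H \<longleftrightarrow> (\<forall>a\<in>H. \<forall>b\<in>H. \<forall>u i.
     geodesic_seq (carrier G) word_dist a b u \<longrightarrow> i \<le> word_dist a b \<longrightarrow> (\<exists>h\<in>H. word_dist (u i) h \<le> R))"

lemma ex_quasiconvex_within:
  assumes "quasiconvex G X H"
  shows "\<exists>K. quasiconvex_within K H"
proof -
  obtain K where K: "\<And>a b S v. \<lbrakk>a \<in> H; b \<in> H; geodesic (cayley_graph G X) (Vertex a) (Vertex b) S;
      Vertex v \<in> S\<rbrakk> \<Longrightarrow> \<exists>h\<in>H. pdist (cayley_graph G X) (Vertex v) (Vertex h) \<le> K"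
    using assms unfolding quasiconvex_def by blast
  have "\<exists>h\<in>H. word_dist (u i) h \<le> nat \<lfloor>K\<rfloor>"
    if ab: "a \<in> H" "b \<in> H" and u: "geodesic_seq (carrier G) word_dist a b u"
      and i: "i \<le> word_dist a b" for a b u i
  proof -
    have "Vertex (u i) \<in> trace u ` {0..real (word_dist a b)}"
      using i by (intro image_eqI[of _ _ "real i"]) auto
    from K[OF ab geodesic_trace[OF u] this]
    obtain h where "h \<in> H" "pdist (cayley_graph G X) (Vertex (u i)) (Vertex h) \<le> K" by blast
    then have "real (word_dist (u i) h) \<le> K" by (simp add: pdist_def)
    with \<open>h \<in> H\<close> show ?thesis using le_nat_floor by blast
  qed
  then show ?thesis unfolding quasiconvex_within_def by blast
qed

end

section \<open>Infinite intersections of conjugates\<close>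

context finitely_generated_group
begin

text \<open>
  Since balls are finite, the infinite intersection contains some \<open>b = inv g \<otimes> h \<otimes> g\<close> with
  \<open>h \<in> H\<close> that is very long compared with \<open>g\<close>. In the quadrilateral with corners \<open>\<one>\<close>, \<open>inv g\<close>,
  \<open>b \<otimes> inv g = inv g \<otimes> h\<close> and \<open>b\<close>, the sides joining \<open>\<one>\<close> to \<open>inv g\<close> and \<open>b\<close> to \<open>b \<otimes> inv g\<close> have
  the length of \<open>g\<close>, so the two long sides come close in between. The long side from \<open>\<one>\<close> to \<open>b\<close> is
  near \<open>H\<close>; the other one is a translate of a geodesic from \<open>\<one>\<close> to \<open>h\<close> and hence near the coset
  of \<open>inv g\<close>. A short path from \<open>H\<close> to that coset is a short element of the double coset.
\<close>

lemma short_double_coset_representative: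
  assumes "thin_space (carrier G) word_dist D" and H: "subgroup H G"
    and qc: "quasiconvex_within R H"
    and g: "g \<in> carrier G" and inf: "infinite (H \<inter> conjugate G H g)"
  shows "\<exists>h\<in>H. \<exists>k\<in>H. word_dist \<one> (h \<otimes> g \<otimes> k) \<le> 2 * R + 2 * D"
proof -
  interpret thin_space "carrier G" word_dist D by fact
  have HG: "h \<in> carrier G" if "h \<in> H" for h using subgroup.mem_carrier[OF H that] .
  let ?f = "inv g"
  define l where "l = word_dist \<one> ?f"
  obtain b where b: "b \<in> H" "b \<in> conjugate G H g" "2 * l + 4 * D + 2 < word_dist \<one> b"
  proof -
    have "\<not> H \<inter> conjugate G H g \<subseteq> {x \<in> carrier G. word_dist \<one> x \<le> 2 * l + 4 * D + 2}"
      using inf finite_word_ball finite_subset by blast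
    then show thesis using that HG by force
  qed
  obtain h where h: "h \<in> H" "b = ?f \<otimes> h \<otimes> g"
    using b(2) unfolding conjugate_def r_coset_def l_coset_def by auto
  have one: "\<one> \<in> H" using H subgroup.one_closed by blast
  have G: "b \<in> carrier G" "h \<in> carrier G" "?f \<in> carrier G" using HG b h g by auto
  have bf: "b \<otimes> ?f = ?f \<otimes> h" using h G g by (simp add: m_assoc)
  have l': "word_dist (b \<otimes> ?f) b = l"
    using word_dist_translate[of b ?f \<one>] G word.dist_sym[of ?f \<one>] by (simp add: l_def)
  obtain u where u: "geodesic_seq (carrier G) word_dist \<one> b u" using word.geodesic_exists G by blast
  obtain a where a: "geodesic_seq (carrier G) word_dist \<one> ?f a" using word.geodesic_exists G by blast
  obtain e where e: "geodesic_seq (carrier G) word_dist (b \<otimes> ?f) b e" using word.geodesic_exists G by blast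
  obtain v where v: "geodesic_seq (carrier G) word_dist \<one> h v" using word.geodesic_exists G by blast
  have fv: "geodesic_seq (carrier G) word_dist ?f (b \<otimes> ?f) (\<lambda>i. ?f \<otimes> v i)"
    using geodesic_seq_translate[OF G(3) v] G bf by simp
  have lenv: "word_dist ?f (b \<otimes> ?f) = word_dist \<one> h"
    using word_dist_translate[of ?f \<one> h] G bf by simp
  \<comment> \<open>Just far enough from \<open>\<one>\<close> to be out of reach of the first short side; the length of \<open>b\<close> makes it
    far from the other one as well.\<close>
  define i where "i = l + 2 * D + 1"
  have i: "i \<le> word_dist \<one> b" using b by (simp add: i_def)
  have ui: "u i \<in> carrier G" "word_dist \<one> (u i) = i" "word_dist (u i) b = word_dist \<one> b - i"
    using word.geodesic_seq_in[OF u i] word.geodesic_seq_dist[OF u, of 0 i]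
      word.geodesic_seq_dist[OF u i order_refl] i word.geodesic_seq_ends[OF u]
    by auto
  obtain j where j: "j \<le> word_dist \<one> h" "word_dist (u i) (?f \<otimes> v j) \<le> 2 * D"
  proof (rule thin_quadrilateral[OF u a fv e i])
    fix j assume j: "j \<le> word_dist \<one> ?f" "word_dist (u i) (a j) \<le> 2 * D"
    have "a j \<in> carrier G" "word_dist \<one> (a j) = j"
      using word.geodesic_seq_in[OF a j(1)] word.geodesic_seq_dist[OF a, of 0 j] word.geodesic_seq_ends[OF a] j
      by auto
    then have "i \<le> j + word_dist (u i) (a j)"
      using word.dist_triangle[of \<one> "a j" "u i"] ui word.dist_sym[of "u i" "a j"] by simp
    then show thesis using j by (simp add: i_def l_def)
  next
    fix j assume j: "j \<le> word_dist (b \<otimes> ?f) b" "word_dist (u i) (e j) \<le> 2 * D"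
    have "e j \<in> carrier G" "word_dist (e j) b \<le> l"
      using word.geodesic_seq_in[OF e j(1)] word.geodesic_seq_dist[OF e j(1) order_refl] word.geodesic_seq_ends[OF e]
        j l'
      by auto
    then have "word_dist (u i) b \<le> word_dist (u i) (e j) + l"
      using word.dist_triangle[of "u i" "e j" b] ui G by simp
    then show thesis using j ui b by (simp add: i_def)
  next
    fix j assume "j \<le> word_dist ?f (b \<otimes> ?f)" "word_dist (u i) (?f \<otimes> v j) \<le> 2 * D"
    then show thesis using that lenv by simp
  qed
  have vj: "v j \<in> carrier G" using word.geodesic_seq_in[OF v j(1)] .
  obtain h1 where h1: "h1 \<in> H" "word_dist (u i) h1 \<le> R"
    using qc one b(1) u i unfolding quasiconvex_within_def by blast
  obtain h2 where h2: "h2 \<in> H" "word_dist (v j) h2 \<le> R"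
    using qc one h(1) v j(1) unfolding quasiconvex_within_def by blast
  have C: "h1 \<in> carrier G" "h2 \<in> carrier G" using HG h1 h2 by auto
  have "word_dist (?f \<otimes> h2) h1 \<le>
      word_dist (?f \<otimes> h2) (?f \<otimes> v j) + word_dist (?f \<otimes> v j) (u i) + word_dist (u i) h1"
    using word.dist_triangle[of "?f \<otimes> h2" "?f \<otimes> v j" h1] word.dist_triangle[of "?f \<otimes> v j" "u i" h1] G C ui vj
    by simp
  also have "word_dist (?f \<otimes> h2) (?f \<otimes> v j) = word_dist (v j) h2"
    using word_dist_translate G C vj word.dist_sym by simp
  also have "word_dist (?f \<otimes> v j) (u i) = word_dist (u i) (?f \<otimes> v j)"
    using G ui vj word.dist_sym by simp
  finally have "word_dist (?f \<otimes> h2) h1 \<le> 2 * R + 2 * D" using h1 h2 j by simp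
  moreover have "word_dist (?f \<otimes> h2) h1 = word_dist \<one> (inv h2 \<otimes> g \<otimes> h1)"
  proof -
    have "g \<otimes> (?f \<otimes> h2) = h2" using C g by (simp add: m_assoc[symmetric])
    then have "inv h2 \<otimes> g \<otimes> (?f \<otimes> h2) = \<one>" using G(3) C g by (simp add: m_assoc)
    then show ?thesis using word_dist_translate[of "inv h2 \<otimes> g" "?f \<otimes> h2" h1] G C g by simp
  qed
  ultimately have "word_dist \<one> (inv h2 \<otimes> g \<otimes> h1) \<le> 2 * R + 2 * D" by simp
  then show ?thesis using h1(1) subgroup.m_inv_closed[OF H h2(1)] by blast
qed

end

text \<open>
  A geodesic for \<open>X\<close> between points of \<open>H\<close> stays near \<open>H\<close> and is a quasigeodesic for \<open>Y\<close>, so the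
  geodesic for \<open>Y\<close> with the same ends stays near it.
\<close>

lemma quasiconvex_change_generators:
  assumes X: "finitely_generated_group G X" and Y: "finitely_generated_group G Y"
    and thin: "thin_space (carrier G) (vertex_dist (cayley_graph G Y)) D"
    and H: "H \<subseteq> carrier G"
    and qc: "finitely_generated_group.quasiconvex_within G X K H"
  shows "\<exists>R. finitely_generated_group.quasiconvex_within G Y R H"
proof -
  interpret X: finitely_generated_group G X by fact
  interpret Y: finitely_generated_group G Y by fact
  interpret thin_space "carrier G" Y.word_dist D by fact
  obtain L where L: "\<And>a b. a \<in> carrier G \<Longrightarrow> b \<in> carrier G \<Longrightarrow> Y.word_dist a b \<le> L * X.word_dist a b"
    using word_dist_lipschitz[OF X Y] by blast
  obtain M where M: "\<And>a b. a \<in> carrier G \<Longrightarrow> b \<in> carrier G \<Longrightarrow> X.word_dist a b \<le> M * Y.word_dist a b"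
    using word_dist_lipschitz[OF Y X] by blast
  obtain R where R: "\<And>N c u i. \<lbrakk>\<forall>j\<le>N. c j \<in> carrier G; \<forall>j<N. Y.word_dist (c j) (c (Suc j)) \<le> L;
      \<forall>j l. j \<le> l \<longrightarrow> l \<le> N \<longrightarrow> l - j \<le> M * Y.word_dist (c j) (c l);
      geodesic_seq (carrier G) Y.word_dist (c 0) (c N) u; i \<le> Y.word_dist (c 0) (c N)\<rbrakk>
      \<Longrightarrow> \<exists>j\<le>N. Y.word_dist (u i) (c j) \<le> R"
    using geodesic_near_quasigeodesic[of L M] by blast
  have "\<exists>h\<in>H. Y.word_dist (u i) h \<le> R + L * K"
    if ab: "a \<in> H" "b \<in> H" and u: "geodesic_seq (carrier G) Y.word_dist a b u"
      and i: "i \<le> Y.word_dist a b" for a b u i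
  proof -
    have V: "a \<in> carrier G" "b \<in> carrier G" using ab H by auto
    obtain c where c: "geodesic_seq (carrier G) X.word_dist a b c" using X.ex_geodesic_seq V by blast
    let ?N = "X.word_dist a b"
    have cV: "c j \<in> carrier G" if "j \<le> ?N" for j using X.word.geodesic_seq_in[OF c that] .
    have cd: "X.word_dist (c j) (c l) = l - j" if "j \<le> l" "l \<le> ?N" for j l
      using X.word.geodesic_seq_dist[OF c that] .
    have ends: "c 0 = a" "c ?N = b" using X.word.geodesic_seq_ends[OF c] by auto
    have "\<exists>j\<le>?N. Y.word_dist (u i) (c j) \<le> R"
    proof (rule R)
      show "\<forall>j<?N. Y.word_dist (c j) (c (Suc j)) \<le> L"
      proof (intro allI impI)
        fix j assume j: "j < ?N"
        show "Y.word_dist (c j) (c (Suc j)) \<le> L"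
          using L[of "c j" "c (Suc j)"] cV j cd[of j "Suc j"] by simp
      qed
      show "\<forall>j l. j \<le> l \<longrightarrow> l \<le> ?N \<longrightarrow> l - j \<le> M * Y.word_dist (c j) (c l)"
      proof (intro allI impI)
        fix j l assume jl: "j \<le> l" "l \<le> ?N"
        show "l - j \<le> M * Y.word_dist (c j) (c l)"
          using M[of "c j" "c l"] cV jl cd[OF jl] by simp
      qed
    qed (use cV u i ends in auto)
    then obtain j where j: "j \<le> ?N" "Y.word_dist (u i) (c j) \<le> R" by blast
    obtain h where h: "h \<in> H" "X.word_dist (c j) h \<le> K"
      using qc ab c j(1) unfolding X.quasiconvex_within_def by blast
    have hV: "h \<in> carrier G" using h H by auto
    have "Y.word_dist (c j) h \<le> L * K"
      using L[OF cV[OF j(1)] hV] h(2) by (meson mult_le_mono2 order_trans)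
    moreover have "Y.word_dist (u i) h \<le> Y.word_dist (u i) (c j) + Y.word_dist (c j) h"
      using Y.word.dist_triangle Y.word.geodesic_seq_in[OF u i] cV[OF j(1)] hV by blast
    ultimately show ?thesis using h j by (intro bexI[of _ h]) auto
  qed
  then show ?thesis unfolding Y.quasiconvex_within_def by blast
qed

lemma (in group) double_coset_eq:
  assumes H: "subgroup H G" and g: "g \<in> carrier G" and hk: "h \<in> H" "k \<in> H"
  shows "double_coset G H (h \<otimes> g \<otimes> k) = double_coset G H g"
proof -
  have HG: "H \<subseteq> carrier G" "h \<in> carrier G" "k \<in> carrier G" using subgroup.subset[OF H] hk by auto
  have "H #> (h \<otimes> g \<otimes> k) = ((H #> h) #> g) #> k"
    using HG g by (simp add: coset_mult_assoc r_coset_subset_G)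
  also have "H #> h = H" using coset_join2 H HG(2) hk(1) by blast
  finally have "double_coset G H (h \<otimes> g \<otimes> k) = ((H #> g) #> k) <#> H"
    by (simp add: double_coset_def)
  also have "\<dots> = (H #> g) <#> (k <# H)"
    using HG g by (simp add: rcos_assoc_lcos r_coset_subset_G)
  also have "k <# H = H" using coset_join3 H HG(3) hk(2) by blast
  finally show ?thesis by (simp add: double_coset_def)
qed

lemma weak_width_finite_if_double_cosets_finite:
  assumes fin: "finite A"
    and dc: "\<And>g. g \<in> carrier G \<Longrightarrow> infinite (H \<inter> conjugate G H g) \<Longrightarrow> double_coset G H g \<in> A"
  shows "weak_width G H < \<infinity>"
proof (cases "finite H")
  case True
  then show ?thesis by (simp add: weak_width_def)
next
  case False
  have bound: "n \<le> Suc (card A)"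
    if g: "strongly_essentially_distinct G H n g"
      and inf: "\<forall>i. 1 \<le> i \<and> i < n \<longrightarrow> infinite (H \<inter> conjugate G H (g i))" for n g
  proof -
    have "inj_on (\<lambda>i. double_coset G H (g i)) {1..<n}"
      using g unfolding strongly_essentially_distinct_def inj_on_def by (meson atLeastLessThan_iff)
    moreover have "(\<lambda>i. double_coset G H (g i)) ` {1..<n} \<subseteq> A"
      using g inf dc unfolding strongly_essentially_distinct_def by auto
    ultimately have "card {1..<n} \<le> card A" using fin by (rule card_inj_on_le)
    then show ?thesis by simp
  qed
  have "weak_width G H \<le> enat (Suc (card A))"
    unfolding weak_width_def using False bound by (auto intro!: Sup_least)
  then show ?thesis using enat_ord_code(4) le_less_trans by blast
qed

theorem theorem1:
  fixes G :: "('a, 'b) monoid_scheme" and X H :: "'a set"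
  assumes "group G"
    and "negatively_curved G"
    and "subgroup H G"
    and "finite_generating_set G X"
    and "quasiconvex G X H"
  shows "weak_width G H < \<infinity>"
proof -
  interpret group G by fact
  obtain Y \<delta> where Y: "finite_generating_set G Y" "thin_triangles (cayley_graph G Y) \<delta>"
    using assms(2) unfolding negatively_curved_def by blast
  interpret X: finitely_generated_group G X using assms(4) by unfold_locales
  interpret Y: finitely_generated_group G Y using Y(1) by unfold_locales
  have thin: "thin_space (carrier G) Y.word_dist (nat \<lfloor>\<delta>\<rfloor>)" using Y.thin_space_word_dist[OF Y(2)] .
  obtain K where "X.quasiconvex_within K H"
    using X.ex_quasiconvex_within[OF assms(5)] by blast
  then obtain R where R: "Y.quasiconvex_within R H"
    using quasiconvex_change_generators[OF X.finitely_generated_group_axioms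
        Y.finitely_generated_group_axioms thin subgroup.subset[OF assms(3)]] by blast
  let ?B = "{g \<in> carrier G. Y.word_dist \<one>\<^bsub>G\<^esub> g \<le> 2 * R + 2 * nat \<lfloor>\<delta>\<rfloor>}"
  show ?thesis
  proof (rule weak_width_finite_if_double_cosets_finite)
    show "finite (double_coset G H ` ?B)" using Y.finite_word_ball by simp
    fix g assume g: "g \<in> carrier G" "infinite (H \<inter> conjugate G H g)"
    obtain h k where hk: "h \<in> H" "k \<in> H" "Y.word_dist \<one>\<^bsub>G\<^esub> (h \<otimes>\<^bsub>G\<^esub> g \<otimes>\<^bsub>G\<^esub> k) \<le> 2 * R + 2 * nat \<lfloor>\<delta>\<rfloor>"
      using Y.short_double_coset_representative[OF thin assms(3) R g] by blast
    have "h \<in> carrier G" "k \<in> carrier G" using hk subgroup.mem_carrier[OF assms(3)] by auto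
    then have "h \<otimes>\<^bsub>G\<^esub> g \<otimes>\<^bsub>G\<^esub> k \<in> ?B" using hk g by simp
    then show "double_coset G H g \<in> double_coset G H ` ?B"
      using double_coset_eq[OF assms(3) g(1) hk(1,2)] by (metis (no_types, lifting) image_eqI)
  qed
qed

end
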